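(* Let $P$ be a primitive stochastic $N\times N$ matrix and $A=(A_i)_{i\in X}$, $X=\{1,\dots,N\}$, a family in $\mathrm{GL}(2,\mathbb R)$ with $\lambda_+(A,P)=\lambda_-(A,P)$. Suppose $C_i\in\mathrm{GL}(2,\mathbb R)$, $i\in X$, are such that all edge matrices $$T_{ij}=C_j^{-1}\widehat A_iC_i=\begin{pmatrix}a_{ij}&b_{ij}\\0&d_{ij}\end{pmatrix}\qquad(P_{ij}>0)$$ are upper triangular, and that the family $(T_{ij})_{P_{ij}>0}$ is not simultaneously diagonalizable. Put $\rho_{ij}=a_{ij}/d_{ij}$ and $\beta_{ij}=b_{ij}/d_{ij}$. Let $(X_k)_{k\ge0}$ be the stationary Markov chain with transition matrix $P$, and define $Z_0=0$ and $$Z_{n+1}=\rho_{X_nX_{n+1}}Z_n+\beta_{X_nX_{n+1}}\qquad(n\ge0).$$ Then there are constants $C,c>0$ such that, for all $n\ge1$ and $t\ge0$, $$\operatorname{Prob}\bigl(\log(1+|Z_n|)>C+\log(n+1)+t\bigr)\le C\exp\left(-c\frac{t^2}{n}\right),$$ and, for all $n\ge1$, $$\mathbb E\log(1+|Z_n|)\le C\sqrt n+C\log(n+1).$$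
   Context: A stochastic matrix $P$ is primitive if some power has all entries positive; $p=p(P)$ is its unique stationary probability row vector, and the stationary chain has $X_0\sim p$. With $A^{(n)}=A_{X_{n-1}}\cdots A_{X_0}$, the Lyapunov exponents are the almost sure constants $\lambda_+(A,P)=\lim_n\frac1n\log\|A^{(n)}\|$ and $\lambda_-(A,P)=-\lim_n\frac1n\log\|(A^{(n)})^{-1}\|$. Normalization: $\widehat A_i=|\det A_i|^{-1/2}A_i$. In this setting the logarithmic diagonal ratio is centered: $\sum_{i,j}p_iP_{ij}\log|\rho_{ij}|=0$ (sum over allowed edges $P_{ij}>0$). If $T_{X_{n-1}X_n}\cdots T_{X_0X_1}=\begin{pmatrix}A_n&B_n\\0&D_n\end{pmatrix}$, then $Z_n=B_n/D_n$. *)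

theory Defs
  imports "HOL-Probability.Probability"
begin

definition stochastic :: "real^'n^'n \<Rightarrow> bool" where
  "stochastic P \<longleftrightarrow> (\<forall>i j. 0 \<le> P $ i $ j) \<and> (\<forall>i. (\<Sum>j\<in>UNIV. P $ i $ j) = 1)"

definition mat_power :: "real^'n^'n \<Rightarrow> nat \<Rightarrow> real^'n^'n" where
  "mat_power P k = (((**) P) ^^ k) (mat 1)"

definition primitive :: "real^'n^'n \<Rightarrow> bool" where
  "primitive P \<longleftrightarrow> (\<exists>k>0. \<forall>i j. 0 < mat_power P k $ i $ j)"

definition stationary_distribution :: "real^'n^'n \<Rightarrow> real^'n \<Rightarrow> bool" where
  "stationary_distribution P p \<longleftrightarrow>
     (\<forall>i. 0 \<le> p $ i) \<and> (\<Sum>i\<in>UNIV. p $ i) = 1 \<and> p v* P = p"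

definition markov_chain ::
  "'w measure \<Rightarrow> (nat \<Rightarrow> 'w \<Rightarrow> 'n) \<Rightarrow> real^'n^'n \<Rightarrow> real^'n \<Rightarrow> bool" where
  "markov_chain M X P p \<longleftrightarrow>
     prob_space M \<and>
     (\<forall>n. X n \<in> measurable M (count_space UNIV)) \<and>
     (\<forall>i. \<P>(\<omega> in M. X 0 \<omega> = i) = p $ i) \<and>
     (\<forall>n x j. \<P>(\<omega> in M. \<forall>k\<le>n. X k \<omega> = x k) > 0 \<longrightarrow>
        \<P>(\<omega> in M. X (Suc n) \<omega> = j \<bar> \<forall>k\<le>n. X k \<omega> = x k) = P $ x n $ j)"

primrec cocycle :: "('n \<Rightarrow> real^2^2) \<Rightarrow> (nat \<Rightarrow> 'n) \<Rightarrow> nat \<Rightarrow> real^2^2" where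
  "cocycle A x 0 = mat 1"
| "cocycle A x (Suc n) = A (x n) ** cocycle A x n"

text \<open>The Lyapunov exponents are the almost sure constants in the next two definitions. They are
  unique, exist by the Furstenberg--Kesten theorem, and depend on the chain only through its law;
  as for integrals and derivatives, each is phrased as ``has value''.\<close>

definition has_upper_lyapunov_exponent ::
  "'w measure \<Rightarrow> (nat \<Rightarrow> 'w \<Rightarrow> 'n) \<Rightarrow> ('n \<Rightarrow> real^2^2) \<Rightarrow> real \<Rightarrow> bool" where
  "has_upper_lyapunov_exponent M X A l \<longleftrightarrow>
     (AE \<omega> in M. (\<lambda>n. 1 / real n * ln (onorm ((*v) (cocycle A (\<lambda>k. X k \<omega>) n)))) \<longlonglongrightarrow> l)"

definition has_lower_lyapunov_exponent ::
  "'w measure \<Rightarrow> (nat \<Rightarrow> 'w \<Rightarrow> 'n) \<Rightarrow> ('n \<Rightarrow> real^2^2) \<Rightarrow> real \<Rightarrow> bool" where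
  "has_lower_lyapunov_exponent M X A l \<longleftrightarrow>
     (AE \<omega> in M. (\<lambda>n. - (1 / real n * ln (onorm ((*v) (matrix_inv (cocycle A (\<lambda>k. X k \<omega>) n))))))
        \<longlonglongrightarrow> l)"

definition normalized :: "real^2^2 \<Rightarrow> real^2^2" where
  "normalized B = (\<bar>det B\<bar> powr (- 1 / 2)) *\<^sub>R B"

definition edge_matrix :: "('n \<Rightarrow> real^2^2) \<Rightarrow> ('n \<Rightarrow> real^2^2) \<Rightarrow> 'n \<Rightarrow> 'n \<Rightarrow> real^2^2" where
  "edge_matrix A C i j = matrix_inv (C j) ** normalized (A i) ** C i"

definition upper_triangular2 :: "real^2^2 \<Rightarrow> bool" where
  "upper_triangular2 T \<longleftrightarrow> T $ 2 $ 1 = 0"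

definition diagonal2 :: "real^2^2 \<Rightarrow> bool" where
  "diagonal2 T \<longleftrightarrow> T $ 1 $ 2 = 0 \<and> T $ 2 $ 1 = 0"

definition simultaneously_diagonalizable :: "(real^2^2) set \<Rightarrow> bool" where
  "simultaneously_diagonalizable \<T> \<longleftrightarrow>
     (\<exists>S. invertible S \<and> (\<forall>T\<in>\<T>. diagonal2 (matrix_inv S ** T ** S)))"

definition diag_ratio :: "real^2^2 \<Rightarrow> real" where
  "diag_ratio T = T $ 1 $ 1 / T $ 2 $ 2"

definition offdiag_ratio :: "real^2^2 \<Rightarrow> real" where
  "offdiag_ratio T = T $ 1 $ 2 / T $ 2 $ 2"

primrec affine_orbit ::
  "('n \<Rightarrow> 'n \<Rightarrow> real) \<Rightarrow> ('n \<Rightarrow> 'n \<Rightarrow> real) \<Rightarrow> (nat \<Rightarrow> 'n) \<Rightarrow> nat \<Rightarrow> real" where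
  "affine_orbit \<rho> \<beta> x 0 = 0"
| "affine_orbit \<rho> \<beta> x (Suc n) =
     \<rho> (x n) (x (Suc n)) * affine_orbit \<rho> \<beta> x n + \<beta> (x n) (x (Suc n))"

end

theory Submission
  imports Defs "HOL-Real_Asymp.Real_Asymp"
begin

text \<open>Equality of the Lyapunov exponents forces the Birkhoff averages of \<open>ln \<bar>\<rho>\<bar>\<close> to tend to \<open>0\<close>, since a
  product of edge matrices and its inverse have diagonal ratio at most a constant times
  \<open>\<parallel>B\<parallel> \<parallel>B\<^sup>-\<^sup>1\<parallel>\<close>, where \<open>B\<close> is the matching cocycle matrix; by stationarity and dominated
  convergence \<open>ln \<bar>\<rho>\<bar>\<close> is centred. A solution \<open>g\<close> of the Poisson equation turns it into martingale
  increments
  \<open>D i j = ln \<bar>\<rho> i j\<bar> + g j - g i\<close>, and \<open>\<bar>Z n\<bar>\<close> is at most \<open>O(n) exp (w n)\<close> for the walk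
  \<open>w (n + 1) = max (w n + D) 0\<close> reflected at \<open>0\<close>. A bound on the expectation of \<open>cosh (\<theta> * w n)\<close>
  gives both claims.\<close>

text \<open>Supplies uniform constants over the finite state space. The summand 1 in the witness
  makes the bound strictly positive, so that later proofs may divide by it or take its logarithm; a
  family with one index uses \<open>unit\<close> as the second index type.\<close>

lemma finite_matrix_bound:
  fixes f :: "'a::finite \<Rightarrow> 'b::finite \<Rightarrow> real"
  shows "\<exists>B>0. \<forall>i j. \<bar>f i j\<bar> \<le> B"
proof (intro exI conjI allI)
  show "1 + (\<Sum>i\<in>UNIV. \<Sum>j\<in>UNIV. \<bar>f i j\<bar>) > 0"
    by (intro add_pos_nonneg sum_nonneg) auto
  fix i j
  have "\<bar>f i j\<bar> \<le> (\<Sum>j\<in>UNIV. \<bar>f i j\<bar>)"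
    by (rule member_le_sum) auto
  also have "\<dots> \<le> (\<Sum>i\<in>UNIV. \<Sum>j\<in>UNIV. \<bar>f i j\<bar>)"
    by (rule member_le_sum) (auto intro: sum_nonneg)
  finally show "\<bar>f i j\<bar> \<le> 1 + (\<Sum>i\<in>UNIV. \<Sum>j\<in>UNIV. \<bar>f i j\<bar>)"
    by simp
qed

section \<open>Expectations along a finite Markov chain\<close>

locale finite_markov_chain = prob_space M
  for M :: "'w measure" +
  fixes X :: "nat \<Rightarrow> 'w \<Rightarrow> 'n::finite" and P :: "real^'n^'n" and p :: "real^'n"
  assumes chain: "markov_chain M X P p"
    and stochastic: "stochastic P"
begin

lemma measurable_X [measurable]: "X n \<in> measurable M (count_space UNIV)"
  using chain by (simp add: markov_chain_def)

section \<open>Cylinder events and functionals of finite paths\<close>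

definition cylinder :: "nat \<Rightarrow> (nat \<Rightarrow> 'n) \<Rightarrow> 'w set" where
  "cylinder n x = {\<omega> \<in> space M. \<forall>k\<le>n. X k \<omega> = x k}"

lemma cylinder_sets [measurable]: "cylinder n x \<in> sets M"
  unfolding cylinder_def by measurable

text \<open>The Markov property with its denominator cleared. A null cylinder, where
  \<open>markov_chain\<close> gives no information, makes both sides 0, so later sums over paths
  need no case distinction.\<close>

lemma prob_cylinder_step:
  "prob {\<omega> \<in> space M. X (Suc n) \<omega> = j \<and> (\<forall>k\<le>n. X k \<omega> = x k)} = prob (cylinder n x) * P $ x n $ j"
proof (cases "prob (cylinder n x) = 0")
  case True
  have "prob {\<omega> \<in> space M. X (Suc n) \<omega> = j \<and> (\<forall>k\<le>n. X k \<omega> = x k)} \<le> prob (cylinder n x)"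
    by (rule finite_measure_mono) (auto simp: cylinder_def)
  with True show ?thesis
    by (simp add: antisym)
next
  case False
  then have "prob (cylinder n x) > 0"
    by (simp add: zero_less_measure_iff)
  then have "cond_prob M (\<lambda>\<omega>. X (Suc n) \<omega> = j) (\<lambda>\<omega>. \<forall>k\<le>n. X k \<omega> = x k) = P $ x n $ j"
    using chain by (simp add: markov_chain_def cylinder_def)
  with False show ?thesis
    by (simp add: cond_prob_def cylinder_def field_simps)
qed

text \<open>Exactly one path on \<open>{..n}\<close> agrees with the trajectory, so one term of the
  sum survives. This turns functionals of the chain into finite combinations of indicators.\<close>

lemma path_decomposition:
  fixes F :: "(nat \<Rightarrow> 'n) \<Rightarrow> real"
  assumes past: "\<And>x y. (\<And>k. k \<le> n \<Longrightarrow> x k = y k) \<Longrightarrow> F x = F y" and "\<omega> \<in> space M"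
  shows "F (\<lambda>k. X k \<omega>) = (\<Sum>x\<in>PiE {..n} (\<lambda>_. UNIV). F x * indicator (cylinder n x) \<omega>)"
proof -
  let ?r = "restrict (\<lambda>k. X k \<omega>) {..n}"
  have "indicator (cylinder n x) \<omega> = (if x = ?r then 1 else (0::real))"
    if "x \<in> PiE {..n} (\<lambda>_. UNIV)" for x
  proof (cases "x = ?r")
    case True
    then show ?thesis
      using assms by (auto simp: cylinder_def)
  next
    case False
    have "\<not> (\<forall>k\<le>n. X k \<omega> = x k)"
    proof
      assume "\<forall>k\<le>n. X k \<omega> = x k"
      \<comment> \<open>Members of \<open>PiE\<close> take the default value
        \<open>undefined\<close> outside \<open>{..n}\<close>, as \<open>?r\<close> does, so
        agreement up to \<open>n\<close> is equality.\<close>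
      then have "x = ?r"
        using that by (auto intro!: ext simp: PiE_def extensional_def)
      with False show False ..
    qed
    then show ?thesis
      using False by (simp add: cylinder_def)
  qed
  then have "(\<Sum>x\<in>PiE {..n} (\<lambda>_. UNIV). F x * indicator (cylinder n x) \<omega>)
      = (\<Sum>x\<in>PiE {..n} (\<lambda>_. UNIV). if x = ?r then F ?r else 0)"
    by (intro sum.cong) auto
  also have "\<dots> = F ?r"
    by (simp add: sum.delta finite_PiE)
  also have "\<dots> = F (\<lambda>k. X k \<omega>)"
    by (rule past) simp
  finally show ?thesis ..
qed

lemma
  fixes F :: "(nat \<Rightarrow> 'n) \<Rightarrow> real"
  assumes past: "\<And>x y. (\<And>k. k \<le> n \<Longrightarrow> x k = y k) \<Longrightarrow> F x = F y"
  shows path_integrable: "integrable M (\<lambda>\<omega>. F (\<lambda>k. X k \<omega>))"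
    and path_expectation: "expectation (\<lambda>\<omega>. F (\<lambda>k. X k \<omega>))
      = (\<Sum>x\<in>PiE {..n} (\<lambda>_. UNIV). F x * prob (cylinder n x))"
proof -
  have "integrable M (\<lambda>\<omega>. F (\<lambda>k. X k \<omega>)) \<longleftrightarrow>
      integrable M (\<lambda>\<omega>. \<Sum>x\<in>PiE {..n} (\<lambda>_. UNIV). F x * indicator (cylinder n x) \<omega>)"
    by (rule Bochner_Integration.integrable_cong[OF refl]) (rule path_decomposition[OF past])
  then show "integrable M (\<lambda>\<omega>. F (\<lambda>k. X k \<omega>))"
    by (simp add: integrable_mult_right emeasure_eq_measure)
  have "expectation (\<lambda>\<omega>. F (\<lambda>k. X k \<omega>)) =
      expectation (\<lambda>\<omega>. \<Sum>x\<in>PiE {..n} (\<lambda>_. UNIV). F x * indicator (cylinder n x) \<omega>)"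
    by (rule Bochner_Integration.integral_cong[OF refl]) (rule path_decomposition[OF past])
  also have "\<dots> = (\<Sum>x\<in>PiE {..n} (\<lambda>_. UNIV). F x * prob (cylinder n x))"
    by (simp add: emeasure_eq_measure)
  finally show "expectation (\<lambda>\<omega>. F (\<lambda>k. X k \<omega>))
      = (\<Sum>x\<in>PiE {..n} (\<lambda>_. UNIV). F x * prob (cylinder n x))" .
qed

text \<open>One-step conditioning stated without conditional expectations: given the path up to time
  \<open>n\<close>, the next state is averaged with the row of \<open>P\<close> at
  \<open>X n\<close>. Both sides expand into finite sums over cylinders, where the Markov property
  applies term by term.\<close>

lemma markov_step:
  fixes G :: "(nat \<Rightarrow> 'n) \<Rightarrow> 'n \<Rightarrow> real"
  assumes past: "\<And>x y j. (\<And>k. k \<le> n \<Longrightarrow> x k = y k) \<Longrightarrow> G x j = G y j"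
  shows "expectation (\<lambda>\<omega>. G (\<lambda>k. X k \<omega>) (X (Suc n) \<omega>))
      = expectation (\<lambda>\<omega>. \<Sum>j\<in>UNIV. P $ X n \<omega> $ j * G (\<lambda>k. X k \<omega>) j)"
proof -
  let ?S = "PiE {..n} (\<lambda>_. UNIV :: 'n set)"
  define E where "E x j = {\<omega> \<in> space M. X (Suc n) \<omega> = j \<and> (\<forall>k\<le>n. X k \<omega> = x k)}" for x j
  have [measurable]: "E x j \<in> sets M" for x j
    unfolding E_def by measurable
  have split: "G (\<lambda>k. X k \<omega>) (X (Suc n) \<omega>) = (\<Sum>j\<in>UNIV. \<Sum>x\<in>?S. G x j * indicator (E x j) \<omega>)"
    if "\<omega> \<in> space M" for \<omega>
  proof -
    have "G (\<lambda>k. X k \<omega>) (X (Suc n) \<omega>) = (\<Sum>j\<in>UNIV. if j = X (Suc n) \<omega> then G (\<lambda>k. X k \<omega>) j else 0)"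
      by (simp add: sum.delta)
    also have "\<dots> = (\<Sum>j\<in>UNIV. \<Sum>x\<in>?S. G x j * indicator (E x j) \<omega>)"
    proof (rule sum.cong[OF refl])
      fix j
      show "(if j = X (Suc n) \<omega> then G (\<lambda>k. X k \<omega>) j else 0) = (\<Sum>x\<in>?S. G x j * indicator (E x j) \<omega>)"
      proof (cases "j = X (Suc n) \<omega>")
        case True
        have "G (\<lambda>k. X k \<omega>) j = (\<Sum>x\<in>?S. G x j * indicator (cylinder n x) \<omega>)"
          by (rule path_decomposition[OF past that])
        also have "\<dots> = (\<Sum>x\<in>?S. G x j * indicator (E x j) \<omega>)"
          using True by (intro sum.cong) (auto simp: E_def cylinder_def indicator_def)
        finally show ?thesis
          using True by simp
      next
        case False
        then show ?thesis
          by (auto simp: E_def intro!: sum.neutral)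
      qed
    qed
    finally show ?thesis .
  qed
  have "expectation (\<lambda>\<omega>. G (\<lambda>k. X k \<omega>) (X (Suc n) \<omega>)) =
      expectation (\<lambda>\<omega>. \<Sum>j\<in>UNIV. \<Sum>x\<in>?S. G x j * indicator (E x j) \<omega>)"
    by (rule Bochner_Integration.integral_cong[OF refl]) (rule split)
  also have "\<dots> = (\<Sum>j\<in>UNIV. \<Sum>x\<in>?S. G x j * prob (E x j))"
    by (simp add: emeasure_eq_measure)
  also have "\<dots> = (\<Sum>x\<in>?S. \<Sum>j\<in>UNIV. G x j * prob (E x j))"
    by (rule sum.swap)
  also have "\<dots> = (\<Sum>x\<in>?S. (\<Sum>j\<in>UNIV. P $ x n $ j * G x j) * prob (cylinder n x))"
    unfolding E_def prob_cylinder_step by (simp add: sum_distrib_left mult_ac)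
  also have "\<dots> = expectation (\<lambda>\<omega>. (\<lambda>x. \<Sum>j\<in>UNIV. P $ x n $ j * G x j) (\<lambda>k. X k \<omega>))"
  proof (rule path_expectation[symmetric])
    fix x y :: "nat \<Rightarrow> 'n"
    assume eq: "\<And>k. k \<le> n \<Longrightarrow> x k = y k"
    show "(\<Sum>j\<in>UNIV. P $ x n $ j * G x j) = (\<Sum>j\<in>UNIV. P $ y n $ j * G y j)"
      using eq past[OF eq] by simp
  qed
  finally show ?thesis
    by simp
qed

text \<open>Triangularity is assumed only on edges of positive probability, so the path must be
  shown to avoid the others. The indicator of a forbidden step has one-step average 0, hence
  expectation 0.\<close>

lemma AE_allowed_edges: "AE \<omega> in M. \<forall>n. P $ X n \<omega> $ X (Suc n) \<omega> > 0"
proof (subst AE_all_countable, rule allI)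
  fix n
  define G where "G = (\<lambda>(x :: nat \<Rightarrow> 'n) j. if P $ x n $ j > 0 then 0 else 1 :: real)"
  have nonneg: "P $ i $ j \<ge> 0" for i j
    using stochastic by (simp add: stochastic_def)
  have "expectation (\<lambda>\<omega>. G (\<lambda>k. X k \<omega>) (X (Suc n) \<omega>))
      = expectation (\<lambda>\<omega>. \<Sum>j\<in>UNIV. P $ X n \<omega> $ j * G (\<lambda>k. X k \<omega>) j)"
    by (rule markov_step) (simp add: G_def)
  also have "\<dots> = expectation (\<lambda>\<omega>. 0)"
    using nonneg by (intro Bochner_Integration.integral_cong refl sum.neutral)
      (auto simp: G_def not_less intro: antisym)
  finally have "expectation (\<lambda>\<omega>. G (\<lambda>k. X k \<omega>) (X (Suc n) \<omega>)) = 0"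
    by simp
  moreover have "integrable M (\<lambda>\<omega>. (\<lambda>x. G x (x (Suc n))) (\<lambda>k. X k \<omega>))"
    by (rule path_integrable[of "Suc n"]) (simp add: G_def)
  ultimately have "AE \<omega> in M. G (\<lambda>k. X k \<omega>) (X (Suc n) \<omega>) = 0"
    by (subst integral_nonneg_eq_0_iff_AE[symmetric]) (auto simp: G_def)
  then show "AE \<omega> in M. P $ X n \<omega> $ X (Suc n) \<omega> > 0"
    by eventually_elim (auto simp: G_def split: if_splits)
qed

text \<open>Induction on time: the Markov step replaces \<open>h\<close> by its average under
  \<open>P\<close>, hence \<open>h\<close> is arbitrary, and stationarity of \<open>p\<close> moves
  that average back to \<open>h\<close>.\<close>

lemma expectation_stationary:
  assumes "stationary_distribution P p"
  shows "expectation (\<lambda>\<omega>. h (X n \<omega>)) = (\<Sum>i\<in>UNIV. p $ i * h i)"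
proof (induction n arbitrary: h)
  case 0
  have "expectation (\<lambda>\<omega>. h (X 0 \<omega>)) =
      expectation (\<lambda>\<omega>. \<Sum>i\<in>UNIV. h i * indicator {\<omega>\<in>space M. X 0 \<omega> = i} \<omega>)"
    by (rule Bochner_Integration.integral_cong) (simp_all add: indicator_def if_distrib cong: if_cong)
  also have "\<dots> = (\<Sum>i\<in>UNIV. h i * prob {\<omega>\<in>space M. X 0 \<omega> = i})"
    by (subst Bochner_Integration.integral_sum) (auto simp: emeasure_eq_measure Int_def conj_ac)
  also have "\<dots> = (\<Sum>i\<in>UNIV. p $ i * h i)"
    using chain by (simp add: markov_chain_def mult.commute)
  finally show ?case .
next
  case (Suc n)
  have "expectation (\<lambda>\<omega>. h (X (Suc n) \<omega>)) = expectation (\<lambda>\<omega>. \<Sum>j\<in>UNIV. P $ X n \<omega> $ j * h j)"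
    using markov_step[of n "\<lambda>_. h"] by simp
  also have "\<dots> = (\<Sum>i\<in>UNIV. p $ i * (\<Sum>j\<in>UNIV. P $ i $ j * h j))"
    by (rule Suc.IH)
  also have "\<dots> = (\<Sum>j\<in>UNIV. (\<Sum>i\<in>UNIV. p $ i * P $ i $ j) * h j)"
    unfolding sum_distrib_left sum_distrib_right by (subst sum.swap) (simp add: mult_ac)
  also have "\<dots> = (\<Sum>j\<in>UNIV. (p v* P) $ j * h j)"
    by (simp add: vector_matrix_mult_def mult.commute)
  also have "\<dots> = (\<Sum>j\<in>UNIV. p $ j * h j)"
    using assms by (simp add: stationary_distribution_def)
  finally show ?case .
qed

lemma expectation_stationary_edge:
  assumes "stationary_distribution P p"
  shows "expectation (\<lambda>\<omega>. f (X n \<omega>) (X (Suc n) \<omega>)) = (\<Sum>i\<in>UNIV. p $ i * (\<Sum>j\<in>UNIV. P $ i $ j * f i j))"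
  using markov_step[of n "\<lambda>x. f (x n)"]
    expectation_stationary[OF assms, of "\<lambda>i. \<Sum>j\<in>UNIV. P $ i $ j * f i j" n]
  by simp

text \<open>By stationarity every Birkhoff average with n > 0 has expectation \<open>?m\<close>,
  while dominated convergence sends these expectations to that of the limit 0.\<close>

lemma edge_mean_zero:
  assumes "stationary_distribution P p"
    and lim: "AE \<omega> in M. (\<lambda>n. (\<Sum>k<n. f (X k \<omega>) (X (Suc k) \<omega>)) / real n) \<longlonglongrightarrow> 0"
  shows "(\<Sum>i\<in>UNIV. p $ i * (\<Sum>j\<in>UNIV. P $ i $ j * f i j)) = (0::real)" (is "?m = 0")
proof -
  obtain B where B0: "B > 0" and B: "\<And>i j. \<bar>f i j\<bar> \<le> B"
    using finite_matrix_bound by metis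
  have f_int: "integrable M (\<lambda>\<omega>. f (X k \<omega>) (X (Suc k) \<omega>))" for k
    using path_integrable[of "Suc k" "\<lambda>x. f (x k) (x (Suc k))"] by simp
  let ?s = "\<lambda>n \<omega>. (\<Sum>k<n. f (X k \<omega>) (X (Suc k) \<omega>)) / real n"
  have "(\<lambda>n. expectation (?s n)) \<longlonglongrightarrow> expectation (\<lambda>_. 0)"
  proof (rule integral_dominated_convergence[where w = "\<lambda>_. B"])
    show "?s n \<in> borel_measurable M" for n
      using f_int by (intro borel_measurable_divide borel_measurable_sum) auto
    show "AE \<omega> in M. norm (?s n \<omega>) \<le> B" for n
    proof (rule AE_I2)
      fix \<omega>
      have "\<bar>\<Sum>k<n. f (X k \<omega>) (X (Suc k) \<omega>)\<bar> \<le> (\<Sum>k<n. B)"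
        using B by (intro order_trans[OF sum_abs] sum_mono)
      then show "norm (?s n \<omega>) \<le> B"
        using B0 by (cases "n = 0") (auto simp: field_simps)
    qed
  qed (use lim in auto)
  \<comment> \<open>At n = 0 the quotient is 0 by the convention for division, so the identity is
    claimed for positive \<open>n\<close> only.\<close>
  moreover have "expectation (?s n) = ?m" if "n > 0" for n
    using that f_int by (simp add: expectation_stationary_edge[OF assms(1)])
  ultimately have "(\<lambda>n. ?m) \<longlonglongrightarrow> 0"
    by (subst (asm) tendsto_cong[where g = "\<lambda>_. ?m"])
      (auto intro!: eventually_mono[OF eventually_gt_at_top[of 0]])
  then show ?thesis
    by (simp add: LIMSEQ_const_iff)
qed

end

section \<open>The Poisson equation\<close>

text \<open>Minimum principle: at a minimiser \<open>i0\<close> the positive row of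
  \<open>mat_power P k\<close> averages the nonnegative values g - m to 0, so all of them
  vanish.\<close>

lemma primitive_harmonic_constant:
  fixes P :: "real^'n^'n"
  assumes "stochastic P" "primitive P" and harm: "P *v g = g"
  shows "g $ i = g $ j"
proof -
  obtain k where k: "\<And>i j. 0 < mat_power P k $ i $ j"
    using assms(2) by (auto simp: primitive_def)
  have one: "P *v 1 = 1"
    using assms(1) by (simp add: stochastic_def matrix_vector_mult_def vec_eq_iff)
  have fixed: "mat_power P k *v h = h" if "P *v h = h" for h and k
    unfolding mat_power_def
    by (induction k) (simp_all add: that flip: matrix_vector_mul_assoc)
  define m where "m = Min (range (($) g))"
  obtain i0 where i0: "g $ i0 = m"
    using Min_in[of "range (($) g)"] unfolding m_def by fastforce
  have m: "g $ j \<ge> m" for j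
    unfolding m_def by (rule Min_le) auto
  have "(\<Sum>j\<in>UNIV. mat_power P k $ i0 $ j * (g $ j - m))
      = (mat_power P k *v g) $ i0 - m * (mat_power P k *v 1) $ i0"
    by (simp add: matrix_vector_mult_def algebra_simps sum_subtractf sum_distrib_left)
  also have "\<dots> = 0"
    by (simp add: fixed harm one i0)
  finally have "\<forall>j\<in>UNIV. mat_power P k $ i0 $ j * (g $ j - m) = 0"
    using k m by (subst (asm) sum_nonneg_eq_0_iff) (auto intro: mult_nonneg_nonneg simp: less_imp_le)
  then have "g $ j = m" for j
    using k[of i0 j] by (metis UNIV_I less_irrefl mult_eq_0_iff right_minus_eq)
  then show ?thesis
    by simp
qed

text \<open>The rank-one perturbation \<open>I - P + 1 p\<^sup>T\<close> of \<open>I - P\<close> is injective, hence onto, and on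
  \<open>p\<close>-centred right-hand sides its solutions solve the unperturbed equation.\<close>

lemma poisson_equation:
  fixes P :: "real^'n^'n"
  assumes "stochastic P" "primitive P" "stationary_distribution P p" and centred: "p \<bullet> h = 0"
  shows "\<exists>g. g - P *v g = h"
proof -
  define L where "L g = g - P *v g + (p \<bullet> g) *\<^sub>R 1" for g :: "real^'n"
  have lin: "linear L"
    unfolding L_def
    by (intro linearI) (simp_all add: matrix_vector_right_distrib inner_add_right algebra_simps
        matrix_vector_mult_scaleR)
  have p1: "p \<bullet> 1 = 1" and pP: "p v* P = p"
    using assms(3) by (simp_all add: stationary_distribution_def inner_vec_def)
  \<comment> \<open>Stationarity makes \<open>L\<close> preserve the \<open>p\<close>-mean. So
    elements of its kernel are centred and hence harmonic, and a solution of \<open>L g = h\<close>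
    inherits the mean 0, which removes the rank-one term.\<close>
  have pL: "p \<bullet> L g = p \<bullet> g" for g
  proof -
    have "p \<bullet> (P *v g) = p \<bullet> g"
      using dot_lmul_matrix[of p P g] pP by simp
    then show ?thesis
      by (simp add: L_def inner_add_right inner_diff_right p1)
  qed
  have "g = 0" if "L g = 0" for g
  proof -
    have pg: "p \<bullet> g = 0"
      using pL[of g] that by simp
    then have "P *v g = g"
      using that by (simp add: L_def)
    then have "g $ i = g $ undefined" for i
      using primitive_harmonic_constant[OF assms(1,2)] by blast
    then have g: "g = (g $ undefined) *\<^sub>R 1"
      by (simp add: vec_eq_iff)
    then have "p \<bullet> g = g $ undefined"
      using p1 by (metis inner_scaleR_right mult.right_neutral)
    with pg g show "g = 0"
      by simp
  qed
  then have "inj L"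
    using lin by (simp add: linear_injective_0)
  then have "surj L"
    using lin by (simp add: linear_injective_imp_surjective)
  then obtain g where g: "L g = h"
    by (metis surjD)
  then have "p \<bullet> g = 0"
    using pL[of g] centred by simp
  with g show ?thesis
    by (auto simp: L_def)
qed

section \<open>Reflected martingales\<close>

text \<open>The Lindley recursion. Reflection at 0 accounts for the additive terms of the affine
  recursion, each of which starts a fresh multiplicative excursion at a bounded level.\<close>

primrec reflected_walk :: "('n \<Rightarrow> 'n \<Rightarrow> real) \<Rightarrow> (nat \<Rightarrow> 'n) \<Rightarrow> nat \<Rightarrow> real" where
  "reflected_walk D x 0 = 0"
| "reflected_walk D x (Suc n) = max (reflected_walk D x n + D (x n) (x (Suc n))) 0"

lemma reflected_walk_nonneg: "reflected_walk D x n \<ge> 0"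
  by (cases n) auto

lemma reflected_walk_cong:
  "(\<And>k. k \<le> n \<Longrightarrow> x k = y k) \<Longrightarrow> reflected_walk D x n = reflected_walk D y n"
  by (induction n) auto

section \<open>Exponential moments of centred bounded increments\<close>

lemma exp_le_quadratic:
  fixes y :: real
  assumes "\<bar>y\<bar> \<le> 1"
  shows "exp y \<le> 1 + y + y\<^sup>2"
proof (cases "y \<ge> 0")
  case True
  then show ?thesis
    using assms exp_bound by simp
next
  case False
  define z where "z = - y"
  have z: "0 \<le> z" "z \<le> 1"
    using False assms by (auto simp: z_def)
  \<comment> \<open>The product equals 1 + z^3.\<close>
  have "1 \<le> (1 + z) * (1 - z + z\<^sup>2)"
    using z by (simp add: algebra_simps power2_eq_square)
  also have "\<dots> \<le> exp z * (1 - z + z\<^sup>2)"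
    using z by (intro mult_right_mono) auto
  finally have "exp (- z) \<le> 1 - z + z\<^sup>2"
    by (simp add: exp_minus field_simps)
  then show ?thesis
    by (simp add: z_def)
qed

text \<open>A Hoeffding-type bound, without the optimal constant. If |theta| B <= 1, the quadratic
  estimate applies and its linear term averages to 0; otherwise theta d <= |theta| B <= (|theta|
  B)^2 already bounds every term.\<close>

lemma centred_exp_moment:
  fixes q d :: "'a \<Rightarrow> real"
  assumes "finite S" "\<And>j. j \<in> S \<Longrightarrow> q j \<ge> 0" "(\<Sum>j\<in>S. q j) = 1"
    and mean: "(\<Sum>j\<in>S. q j * d j) = 0" and d: "\<And>j. j \<in> S \<Longrightarrow> \<bar>d j\<bar> \<le> B" and "B \<ge> 0"
  shows "(\<Sum>j\<in>S. q j * exp (\<theta> * d j)) \<le> exp (\<theta>\<^sup>2 * B\<^sup>2)"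
proof (cases "\<bar>\<theta>\<bar> * B \<le> 1")
  case True
  have "(\<Sum>j\<in>S. q j * exp (\<theta> * d j)) \<le> (\<Sum>j\<in>S. q j * (1 + \<theta> * d j + \<theta>\<^sup>2 * B\<^sup>2))"
  proof (intro sum_mono mult_left_mono)
    fix j assume j: "j \<in> S"
    have le: "\<bar>\<theta> * d j\<bar> \<le> \<bar>\<theta>\<bar> * B"
      using d[OF j] by (simp add: abs_mult mult_left_mono)
    then have "(\<theta> * d j)\<^sup>2 \<le> \<theta>\<^sup>2 * B\<^sup>2"
      using power_mono[OF le, of 2] by (simp add: power_mult_distrib)
    moreover have "exp (\<theta> * d j) \<le> 1 + \<theta> * d j + (\<theta> * d j)\<^sup>2"
      using le True by (intro exp_le_quadratic) simp
    ultimately show "exp (\<theta> * d j) \<le> 1 + \<theta> * d j + \<theta>\<^sup>2 * B\<^sup>2"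
      by simp
  qed (use assms in auto)
  also have "\<dots> = (\<Sum>j\<in>S. q j) + \<theta> * (\<Sum>j\<in>S. q j * d j) + \<theta>\<^sup>2 * B\<^sup>2 * (\<Sum>j\<in>S. q j)"
    by (simp add: distrib_left sum.distrib sum_distrib_left sum_distrib_right mult_ac)
  also have "\<dots> \<le> exp (\<theta>\<^sup>2 * B\<^sup>2)"
    using assms(3) mean by simp
  finally show ?thesis .
next
  case False
  have "(\<Sum>j\<in>S. q j * exp (\<theta> * d j)) \<le> (\<Sum>j\<in>S. q j * exp (\<theta>\<^sup>2 * B\<^sup>2))"
  proof (intro sum_mono mult_left_mono)
    fix j assume j: "j \<in> S"
    have "\<theta> * d j \<le> \<bar>\<theta>\<bar> * B"
      by (rule order_trans[OF abs_ge_self]) (simp add: abs_mult d[OF j] mult_left_mono)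
    also have "\<dots> \<le> (\<bar>\<theta>\<bar> * B)\<^sup>2"
      by (rule self_le_power) (use False in auto)
    finally show "exp (\<theta> * d j) \<le> exp (\<theta>\<^sup>2 * B\<^sup>2)"
      by (simp add: power_mult_distrib)
  qed (use assms in auto)
  also have "\<dots> = exp (\<theta>\<^sup>2 * B\<^sup>2)"
    using assms(3) by (simp flip: sum_distrib_right)
  finally show ?thesis .
qed

text \<open>Unlike \<open>exp\<close>, the even function \<open>cosh\<close> does not increase when its argument is reflected at
  \<open>0\<close>, so no factor \<open>n\<close> is lost in the following bound.\<close>

lemma (in finite_markov_chain) reflected_walk_cosh:
  assumes mean: "\<And>i. (\<Sum>j\<in>UNIV. P $ i $ j * D i j) = 0" and D: "\<And>i j. \<bar>D i j\<bar> \<le> B"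
  shows "expectation (\<lambda>\<omega>. cosh (\<theta> * reflected_walk D (\<lambda>k. X k \<omega>) n)) \<le> exp (real n * (\<theta>\<^sup>2 * B\<^sup>2))"
proof (induction n)
  case 0
  then show ?case
    by (simp add: prob_space)
next
  case (Suc n)
  have B: "B \<ge> 0"
    using D by (meson abs_ge_zero order_trans)
  have P: "P $ i $ j \<ge> 0" "(\<Sum>j\<in>UNIV. P $ i $ j) = 1" for i j
    using stochastic by (simp_all add: stochastic_def)
  let ?w = "reflected_walk D"
  define G where "G x j = cosh (\<theta> * max (?w x n + D (x n) j) 0)" for x j
  have cong: "G x j = G y j" if "\<And>k. k \<le> n \<Longrightarrow> x k = y k" for x y j
    using that reflected_walk_cong[of n x y D] by (simp add: G_def)
  have step: "(\<Sum>j\<in>UNIV. P $ x n $ j * G x j) \<le> exp (\<theta>\<^sup>2 * B\<^sup>2) * cosh (\<theta> * ?w x n)" for x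
  proof -
    \<comment> \<open>Where the maximum is 0, the term on the left is cosh 0 = 1, the least value of
      cosh.\<close>
    have "(\<Sum>j\<in>UNIV. P $ x n $ j * G x j)
        \<le> (\<Sum>j\<in>UNIV. P $ x n $ j * cosh (\<theta> * (?w x n + D (x n) j)))"
      using P by (intro sum_mono mult_left_mono) (auto simp: G_def max_def cosh_real_ge_1)
    \<comment> \<open>Splitting cosh into two exponentials lets the centred moment bound be used at
      \<open>\<theta>\<close> and at \<open>- \<theta>\<close>, with the same right-hand
      side.\<close>
    also have "\<dots> = (exp (\<theta> * ?w x n) * (\<Sum>j\<in>UNIV. P $ x n $ j * exp (\<theta> * D (x n) j))
        + exp (- \<theta> * ?w x n) * (\<Sum>j\<in>UNIV. P $ x n $ j * exp (- \<theta> * D (x n) j))) / 2"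
    proof -
      have "P $ x n $ j * cosh (\<theta> * (?w x n + D (x n) j))
          = exp (\<theta> * ?w x n) * (P $ x n $ j * exp (\<theta> * D (x n) j)) / 2
            + exp (- \<theta> * ?w x n) * (P $ x n $ j * exp (- \<theta> * D (x n) j)) / 2" for j
        by (simp add: cosh_field_def distrib_left exp_add exp_diff exp_minus field_simps)
      then show ?thesis
        by (simp add: sum.distrib sum_distrib_left sum_divide_distrib add_divide_distrib)
    qed
    also have "\<dots> \<le> (exp (\<theta> * ?w x n) * exp (\<theta>\<^sup>2 * B\<^sup>2)
        + exp (- \<theta> * ?w x n) * exp ((- \<theta>)\<^sup>2 * B\<^sup>2)) / 2"
      using P mean D B
      by (intro divide_right_mono add_mono mult_left_mono centred_exp_moment) auto
    also have "\<dots> = exp (\<theta>\<^sup>2 * B\<^sup>2) * cosh (\<theta> * ?w x n)"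
      by (simp add: cosh_field_def field_simps)
    finally show ?thesis .
  qed
  have "expectation (\<lambda>\<omega>. cosh (\<theta> * ?w (\<lambda>k. X k \<omega>) (Suc n)))
      = expectation (\<lambda>\<omega>. G (\<lambda>k. X k \<omega>) (X (Suc n) \<omega>))"
    by (simp add: G_def)
  also have "\<dots> = expectation (\<lambda>\<omega>. \<Sum>j\<in>UNIV. P $ X n \<omega> $ j * G (\<lambda>k. X k \<omega>) j)"
    by (rule markov_step) (rule cong)
  also have "\<dots> \<le> expectation (\<lambda>\<omega>. exp (\<theta>\<^sup>2 * B\<^sup>2) * cosh (\<theta> * ?w (\<lambda>k. X k \<omega>) n))"
  proof (rule integral_mono)
    show "integrable M (\<lambda>\<omega>. \<Sum>j\<in>UNIV. P $ X n \<omega> $ j * G (\<lambda>k. X k \<omega>) j)"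
    proof (rule path_integrable[of n "\<lambda>x. \<Sum>j\<in>UNIV. P $ x n $ j * G x j"])
      fix x y :: "nat \<Rightarrow> 'n"
      assume eq: "\<And>k. k \<le> n \<Longrightarrow> x k = y k"
      show "(\<Sum>j\<in>UNIV. P $ x n $ j * G x j) = (\<Sum>j\<in>UNIV. P $ y n $ j * G y j)"
        using eq cong[OF eq] by simp
    qed
    show "integrable M (\<lambda>\<omega>. exp (\<theta>\<^sup>2 * B\<^sup>2) * cosh (\<theta> * ?w (\<lambda>k. X k \<omega>) n))"
      by (intro integrable_mult_right path_integrable[of n "\<lambda>x. cosh (\<theta> * ?w x n)"])
        (metis reflected_walk_cong)
  qed (rule step)
  also have "\<dots> \<le> exp (\<theta>\<^sup>2 * B\<^sup>2) * exp (real n * (\<theta>\<^sup>2 * B\<^sup>2))"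
    using Suc.IH by (simp add: mult_left_mono)
  also have "\<dots> = exp (real (Suc n) * (\<theta>\<^sup>2 * B\<^sup>2))"
    by (simp add: exp_add[symmetric] algebra_simps)
  finally show ?case .
qed

lemma (in finite_markov_chain) reflected_walk_integrable:
  "integrable M (\<lambda>\<omega>. reflected_walk D (\<lambda>k. X k \<omega>) n)"
  by (rule path_integrable[of n "\<lambda>x. reflected_walk D x n"]) (rule reflected_walk_cong)

lemma (in finite_markov_chain) reflected_walk_cosh_integrable:
  "integrable M (\<lambda>\<omega>. cosh (\<theta> * reflected_walk D (\<lambda>k. X k \<omega>) n))"
  by (rule path_integrable[of n "\<lambda>x. cosh (\<theta> * reflected_walk D x n)"]) (metis reflected_walk_cong)

text \<open>Chernoff's method with cosh in place of exp: Markov's inequality is applied to cosh of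
  \<open>\<theta>\<close> times the walk, and cosh >= exp / 2 gives the prefactor 2.\<close>

lemma (in finite_markov_chain) reflected_walk_tail:
  assumes mean: "\<And>i. (\<Sum>j\<in>UNIV. P $ i $ j * D i j) = 0" and D: "\<And>i j. \<bar>D i j\<bar> \<le> B"
    and "B > 0" "n \<ge> 1" "t \<ge> 0"
  shows "\<P>(\<omega> in M. reflected_walk D (\<lambda>k. X k \<omega>) n > t) \<le> 2 * exp (- (t\<^sup>2 / (4 * B\<^sup>2 * real n)))"
proof -
  let ?w = "\<lambda>\<omega>. reflected_walk D (\<lambda>k. X k \<omega>) n"
  \<comment> \<open>This value minimises n theta^2 B^2 - theta t, with minimum -t^2 / (4 B^2
    n).\<close>
  define \<theta> where "\<theta> = t / (2 * real n * B\<^sup>2)"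
  have \<theta>: "\<theta> \<ge> 0"
    using assms by (simp add: \<theta>_def)
  have [measurable]: "?w \<in> borel_measurable M"
    using reflected_walk_integrable by auto
  have "\<P>(\<omega> in M. ?w \<omega> > t) \<le> prob {\<omega> \<in> space M. cosh (\<theta> * ?w \<omega>) \<ge> cosh (\<theta> * t)}"
  proof (rule finite_measure_mono)
    show "{\<omega> \<in> space M. cosh (\<theta> * ?w \<omega>) \<ge> cosh (\<theta> * t)} \<in> sets M"
      using reflected_walk_cosh_integrable by measurable
    show "{\<omega> \<in> space M. ?w \<omega> > t} \<subseteq> {\<omega> \<in> space M. cosh (\<theta> * ?w \<omega>) \<ge> cosh (\<theta> * t)}"
      using \<theta> \<open>t \<ge> 0\<close> by (auto simp: cosh_real_nonneg_le_iff mult_left_mono)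
  qed
  also have "\<dots> \<le> expectation (\<lambda>\<omega>. cosh (\<theta> * ?w \<omega>)) / cosh (\<theta> * t)"
    by (rule integral_Markov_inequality_measure[where A = "{}"])
      (auto simp: reflected_walk_cosh_integrable cosh_real_pos)
  also have "\<dots> \<le> exp (real n * (\<theta>\<^sup>2 * B\<^sup>2)) / (exp (\<theta> * t) / 2)"
    using reflected_walk_cosh[OF mean D]
    by (intro frac_le) (auto simp: cosh_field_def)
  also have "\<dots> = 2 * exp (real n * (\<theta>\<^sup>2 * B\<^sup>2) - \<theta> * t)"
    by (simp add: exp_diff)
  also have "real n * (\<theta>\<^sup>2 * B\<^sup>2) - \<theta> * t = - (t\<^sup>2 / (4 * B\<^sup>2 * real n))"
    using assms by (simp add: \<theta>_def field_simps power2_eq_square)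
  finally show ?thesis .
qed

lemma (in finite_markov_chain) reflected_walk_mean:
  assumes mean: "\<And>i. (\<Sum>j\<in>UNIV. P $ i $ j * D i j) = 0" and D: "\<And>i j. \<bar>D i j\<bar> \<le> B"
    and "n \<ge> 1"
  shows "expectation (\<lambda>\<omega>. reflected_walk D (\<lambda>k. X k \<omega>) n) \<le> 2 * exp (B\<^sup>2) * sqrt (real n)"
proof -
  \<comment> \<open>At this scale the cosh moment is at most exp (B^2) uniformly in
    \<open>n\<close>, and undoing the scaling costs the factor sqrt n.\<close>
  define \<theta> where "\<theta> = 1 / sqrt (real n)"
  have n: "sqrt (real n) > 0"
    using assms by simp
  have pointwise: "w \<le> 2 * sqrt (real n) * cosh (\<theta> * w)" for w
  proof -
    have "\<theta> * w \<le> exp (\<theta> * w)"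
      using exp_ge_add_one_self[of "\<theta> * w"] by linarith
    also have "\<dots> \<le> 2 * cosh (\<theta> * w)"
      by (simp add: cosh_field_def)
    finally show ?thesis
      using n by (simp add: \<theta>_def field_simps)
  qed
  have "expectation (\<lambda>\<omega>. reflected_walk D (\<lambda>k. X k \<omega>) n)
      \<le> expectation (\<lambda>\<omega>. 2 * sqrt (real n) * cosh (\<theta> * reflected_walk D (\<lambda>k. X k \<omega>) n))"
    by (intro integral_mono reflected_walk_integrable integrable_mult_right
        reflected_walk_cosh_integrable pointwise)
  also have "\<dots> \<le> 2 * sqrt (real n) * exp (real n * (\<theta>\<^sup>2 * B\<^sup>2))"
    using reflected_walk_cosh[OF mean D] by (simp add: mult_left_mono)
  also have "real n * (\<theta>\<^sup>2 * B\<^sup>2) = B\<^sup>2"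
    using n by (simp add: \<theta>_def power_divide)
  finally show ?thesis
    by (simp add: mult_ac)
qed

section \<open>Affine orbits\<close>

lemma affine_orbit_cong:
  "(\<And>k. k \<le> n \<Longrightarrow> x k = y k) \<Longrightarrow> affine_orbit \<rho> \<beta> x n = affine_orbit \<rho> \<beta> y n"
  by (induction n) auto

text \<open>The weight \<open>exp (g (x n))\<close> absorbs the coboundary g i - g j, so the
  weighted orbit grows by the factor exp D in one step and gains at most b exp G. Each of the
  \<open>n\<close> gains is carried along by the reflected walk, so together they cost a factor
  \<open>n\<close>. Removing the weight costs another exp G.\<close>

lemma affine_orbit_le_reflected_walk:
  assumes \<rho>: "\<And>i j. \<bar>\<rho> i j\<bar> \<le> exp (D i j + g i - g j)" and \<beta>: "\<And>i j. \<bar>\<beta> i j\<bar> \<le> b"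
    and g: "\<And>i. \<bar>g i\<bar> \<le> G"
  shows "\<bar>affine_orbit \<rho> \<beta> x n\<bar> \<le> real n * (b * exp (2 * G)) * exp (reflected_walk D x n)"
proof -
  let ?w = "reflected_walk D x" and ?Z = "affine_orbit \<rho> \<beta> x"
  have b: "b \<ge> 0"
    using \<beta> by (meson abs_ge_zero order_trans)
  have weighted: "\<bar>?Z n\<bar> * exp (g (x n)) \<le> real n * (b * exp G) * exp (?w n)"
  proof (induction n)
    case (Suc n)
    let ?D = "D (x n) (x (Suc n))"
    have "\<bar>?Z (Suc n)\<bar> \<le> exp (?D + g (x n) - g (x (Suc n))) * \<bar>?Z n\<bar> + b"
      by (auto simp: abs_mult intro!: order_trans[OF abs_triangle_ineq] add_mono mult_right_mono \<rho> \<beta>)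
    then have "\<bar>?Z (Suc n)\<bar> * exp (g (x (Suc n)))
        \<le> (exp (?D + g (x n) - g (x (Suc n))) * \<bar>?Z n\<bar> + b) * exp (g (x (Suc n)))"
      by (intro mult_right_mono) auto
    also have "\<dots> = exp ?D * (\<bar>?Z n\<bar> * exp (g (x n))) + b * exp (g (x (Suc n)))"
      by (simp add: exp_add exp_diff field_simps)
    also have "\<dots> \<le> exp ?D * (real n * (b * exp G) * exp (?w n)) + b * exp G"
      using b Suc.IH g[of "x (Suc n)"] by (intro add_mono mult_left_mono) auto
    also have "\<dots> = real n * (b * exp G) * exp (?w n + ?D) + (b * exp G) * exp 0"
      by (simp add: exp_add mult_ac)
    \<comment> \<open>\<open>?w (Suc n)\<close> is the maximum of \<open>?w n + ?D\<close> and 0, so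
      it dominates both exponents; this is where reflection is used.\<close>
    also have "\<dots> \<le> real n * (b * exp G) * exp (?w (Suc n)) + (b * exp G) * exp (?w (Suc n))"
      using b by (intro add_mono mult_left_mono) auto
    also have "\<dots> = real (Suc n) * (b * exp G) * exp (?w (Suc n))"
      by (simp add: algebra_simps)
    finally show ?case .
  qed simp
  have "\<bar>?Z n\<bar> = \<bar>?Z n\<bar> * exp (g (x n)) * exp (- g (x n))"
    by (simp add: exp_minus)
  also have "\<dots> \<le> real n * (b * exp G) * exp (?w n) * exp G"
    by (rule mult_mono[OF weighted]) (use g[of "x n"] b in auto)
  also have "\<dots> = real n * (b * exp (2 * G)) * exp (?w n)"
    by (simp add: exp_double power2_eq_square)
  finally show ?thesis .
qed

lemma ln_affine_orbit_le_reflected_walk: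
  assumes "\<And>i j. \<bar>\<rho> i j\<bar> \<le> exp (D i j + g i - g j)" and \<beta>: "\<And>i j. \<bar>\<beta> i j\<bar> \<le> b"
    and "\<And>i. \<bar>g i\<bar> \<le> G"
  shows "ln (1 + \<bar>affine_orbit \<rho> \<beta> x n\<bar>)
    \<le> ln (1 + b * exp (2 * G)) + ln (real n + 1) + reflected_walk D x n"
proof -
  let ?w = "reflected_walk D x n" and ?c = "b * exp (2 * G)"
  have "b \<ge> 0"
    using \<beta> by (meson abs_ge_zero order_trans)
  then have c: "?c \<ge> 0"
    by simp
  have "1 + \<bar>affine_orbit \<rho> \<beta> x n\<bar> \<le> 1 * exp ?w + real n * ?c * exp ?w"
    using affine_orbit_le_reflected_walk[of \<rho> D g \<beta> b G x n] assms reflected_walk_nonneg[of D x n]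
    by (intro add_mono) auto
  \<comment> \<open>The added nonnegative terms complete the product of 1 + \<open>?c\<close> and n
    + 1, whose logarithm splits.\<close>
  also have "\<dots> \<le> 1 * exp ?w + real n * ?c * exp ?w + (real n + ?c) * exp ?w"
    using c by simp
  also have "\<dots> = (1 + ?c) * (real n + 1) * exp ?w"
    by (simp add: algebra_simps)
  finally have "ln (1 + \<bar>affine_orbit \<rho> \<beta> x n\<bar>) \<le> ln ((1 + ?c) * (real n + 1) * exp ?w)"
    by (simp add: ln_mono)
  also have "\<dots> = ln (1 + ?c) + ln (real n + 1) + ?w"
    using c by (simp add: ln_mult add_pos_nonneg)
  finally show ?thesis .
qed

section \<open>Diagonal ratios and Lyapunov exponents\<close>

text \<open>\<open>matrix_inv\<close> is a Hilbert choice, so both equations come from the choice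
  property applied to an existing two-sided inverse.\<close>

lemma
  fixes B :: "'a::semiring_1^'n^'n"
  assumes "invertible B"
  shows matrix_inv_mult_right: "B ** matrix_inv B = mat 1"
    and matrix_inv_mult_left: "matrix_inv B ** B = mat 1"
  using someI_ex[OF assms[unfolded invertible_def]] by (auto simp: matrix_inv_def)

text \<open>Cancellation in right-nested form, so that simplification can contract products of
  conjugated matrices after reassociation.\<close>

lemma
  fixes B :: "'a::semiring_1^'n^'n" and V :: "'a^'k^'n"
  assumes "invertible B"
  shows matrix_inv_cancel_right: "B ** (matrix_inv B ** V) = V"
    and matrix_inv_cancel_left: "matrix_inv B ** (B ** V) = V"
  by (simp_all add: matrix_mul_assoc matrix_inv_mult_right matrix_inv_mult_left assms)

lemma invertible_cocycle:
  assumes "\<And>i. invertible (A i)"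
  shows "invertible (cocycle A x n)"
proof (induction n)
  case 0
  show ?case
    by (auto simp: invertible_def intro: exI[of _ "mat 1"])
qed (simp add: assms invertible_mult)

lemma onorm_matrix_mult_le:
  fixes B :: "real^'m^'k" and V :: "real^'n^'m"
  shows "onorm ((*v) (B ** V)) \<le> onorm ((*v) B) * onorm ((*v) V)"
  using onorm_compose[of "(*v) B" "(*v) V"] by (simp add: o_def matrix_vector_mul_assoc)

text \<open>An invertible matrix does not kill the all-ones vector. Positivity is what lets the
  logarithm of a product of norms split.\<close>

lemma onorm_invertible_pos:
  fixes B :: "real^'n^'n"
  assumes "invertible B"
  shows "onorm ((*v) B) > 0"
proof -
  have "matrix_inv B *v (B *v 1) = 1"
    by (simp add: matrix_vector_mul_assoc matrix_inv_mult_left assms)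
  then have "B *v 1 \<noteq> 0"
    by (metis matrix_vector_mult_0_right one_neq_zero)
  then show ?thesis
    by (subst onorm_pos_lt) auto
qed

section \<open>Products of edge matrices and their diagonals\<close>

primrec edge_product :: "('n \<Rightarrow> 'n \<Rightarrow> real^2^2) \<Rightarrow> (nat \<Rightarrow> 'n) \<Rightarrow> nat \<Rightarrow> real^2^2" where
  "edge_product T x 0 = mat 1"
| "edge_product T x (Suc n) = T (x n) (x (Suc n)) ** edge_product T x n"

text \<open>The inner factors \<open>C (x k)\<close> and their inverses cancel between consecutive
  edges. The scalar \<open>s\<close> collects the determinant normalizations; its value is left open
  since it later cancels against 1 / s in the inverse.\<close>

lemma edge_product_conjugate:
  assumes A: "\<And>i. invertible (A i)" and C: "\<And>i. invertible (C i)"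
  shows "\<exists>s>0. edge_product (edge_matrix A C) x n
    = s *\<^sub>R (matrix_inv (C (x n)) ** (cocycle A x n ** C (x 0)))"
proof (induction n)
  case 0
  show ?case
    by (intro exI[of _ 1]) (simp add: matrix_inv_mult_left C)
next
  case (Suc n)
  then obtain s where s: "s > 0" "edge_product (edge_matrix A C) x n
    = s *\<^sub>R (matrix_inv (C (x n)) ** (cocycle A x n ** C (x 0)))"
    by blast
  define r where "r = \<bar>det (A (x n))\<bar> powr (- 1 / 2)"
  have "r > 0"
    using A[of "x n"] by (simp add: r_def invertible_det_nz)
  have "edge_product (edge_matrix A C) x (Suc n)
      = (s * r) *\<^sub>R (matrix_inv (C (x (Suc n))) ** (A (x n) ** (C (x n) **
          (matrix_inv (C (x n)) ** (cocycle A x n ** C (x 0))))))"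
    by (simp add: s edge_matrix_def normalized_def matrix_scalar_ac
        matrix_mul_assoc[symmetric] r_def flip: scalar_matrix_assoc)
  also have "\<dots> = (s * r) *\<^sub>R (matrix_inv (C (x (Suc n))) ** (cocycle A x (Suc n) ** C (x 0)))"
    by (simp add: matrix_inv_cancel_right C matrix_mul_assoc[symmetric])
  finally show ?case
    using \<open>r > 0\<close> s(1) by (intro exI[of _ "s * r"]) simp
qed

text \<open>The first column of the product forces the lower left entry of \<open>V\<close> to
  vanish, after which each diagonal entry of the product is a single term. This gives both nonzero
  diagonals and the reciprocal entries of the inverse.\<close>

lemma left_inverse_upper_triangular2:
  fixes U V :: "real^2^2"
  assumes "V ** U = mat 1" and "upper_triangular2 U"
  shows "V $ 1 $ 1 * U $ 1 $ 1 = 1" and "V $ 2 $ 2 * U $ 2 $ 2 = 1"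
proof -
  have entry: "V $ i $ 1 * U $ 1 $ j + V $ i $ 2 * U $ 2 $ j = (if i = j then 1 else 0)" for i j
  proof -
    have "(V ** U) $ i $ j = (if i = j then 1 else 0)"
      by (simp add: assms(1) mat_def)
    then show ?thesis
      by (simp add: matrix_matrix_mult_def sum_2)
  qed
  show *: "V $ 1 $ 1 * U $ 1 $ 1 = 1"
    using entry[of 1 1] assms(2) by (simp add: upper_triangular2_def)
  then have "U $ 1 $ 1 \<noteq> 0"
    by auto
  then have "V $ 2 $ 1 = 0"
    using entry[of 2 1] assms(2) by (simp add: upper_triangular2_def)
  then show "V $ 2 $ 2 * U $ 2 $ 2 = 1"
    using entry[of 2 2] by simp
qed

text \<open>Diagonal entries multiply along products of upper triangular matrices. Invertibility of
  every partial product keeps them nonzero, as additivity of \<open>ln\<close> requires.\<close>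

lemma sum_ln_diag_ratio:
  fixes T :: "'n \<Rightarrow> 'n \<Rightarrow> real^2^2"
  assumes tri: "\<And>k. upper_triangular2 (T (x k) (x (Suc k)))"
    and inv: "\<And>n. invertible (edge_product T x n)"
  shows "upper_triangular2 (edge_product T x n)"
    and "(\<Sum>k<n. ln \<bar>diag_ratio (T (x k) (x (Suc k)))\<bar>) = ln \<bar>diag_ratio (edge_product T x n)\<bar>"
proof -
  let ?U = "edge_product T x"
  show upper: "upper_triangular2 (?U n)" for n
    using tri by (induction n)
      (auto simp: upper_triangular2_def mat_def matrix_matrix_mult_def sum_2)
  have nonzero: "?U n $ 1 $ 1 \<noteq> 0" "?U n $ 2 $ 2 \<noteq> 0" for n
    using left_inverse_upper_triangular2[OF matrix_inv_mult_left[OF inv] upper, of n]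
    by auto
  show "(\<Sum>k<n. ln \<bar>diag_ratio (T (x k) (x (Suc k)))\<bar>) = ln \<bar>diag_ratio (?U n)\<bar>"
  proof (induction n)
    case 0
    then show ?case
      by (simp add: diag_ratio_def mat_def)
  next
    case (Suc n)
    let ?T = "T (x n) (x (Suc n))"
    have step: "?U (Suc n) $ 1 $ 1 = ?T $ 1 $ 1 * ?U n $ 1 $ 1"
        "?U (Suc n) $ 2 $ 2 = ?T $ 2 $ 2 * ?U n $ 2 $ 2"
      using upper[of n] tri[of n] by (simp_all add: upper_triangular2_def matrix_matrix_mult_def sum_2)
    \<comment> \<open>The diagonal entries of a single edge matrix are factors of those of the next
      partial product, which are nonzero.\<close>
    then have "?T $ 1 $ 1 \<noteq> 0" "?T $ 2 $ 2 \<noteq> 0"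
      using nonzero[of "Suc n"] by auto
    then have "diag_ratio ?T \<noteq> 0" "diag_ratio (?U n) \<noteq> 0"
      using nonzero[of n] by (simp_all add: diag_ratio_def)
    moreover have "diag_ratio (?U (Suc n)) = diag_ratio ?T * diag_ratio (?U n)"
      unfolding diag_ratio_def step by simp
    ultimately show ?case
      by (simp add: Suc.IH abs_mult ln_mult del: edge_product.simps)
  qed
qed

text \<open>With U the edge product and V its inverse, the diagonal ratio of U is U_11 V_22 and its
  reciprocal is U_22 V_11. Entries are bounded by operator norms, and U and V are conjugate, up to
  reciprocal scalars, to the cocycle matrix and its inverse; so only a constant uniform in path and
  time is lost.\<close>

lemma sum_ln_diag_ratio_le:
  fixes A C :: "'n::finite \<Rightarrow> real^2^2"
  assumes A: "\<And>i. invertible (A i)" and C: "\<And>i. invertible (C i)"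
  shows "\<exists>K. \<forall>x n. (\<forall>k. upper_triangular2 (edge_matrix A C (x k) (x (Suc k)))) \<longrightarrow>
    \<bar>\<Sum>k<n. ln \<bar>diag_ratio (edge_matrix A C (x k) (x (Suc k)))\<bar>\<bar>
    \<le> K + (ln (onorm ((*v) (cocycle A x n))) + ln (onorm ((*v) (matrix_inv (cocycle A x n)))))"
proof -
  let ?N = "\<lambda>B :: real^2^2. onorm ((*v) B)"
  \<comment> \<open>\<open>c\<close> bounds all the conjugating matrices and their inverses at once.
    Four of them occur in a product of an entry of U and one of V, whence \<open>c ^ 4\<close>
    below.\<close>
  obtain c where c0: "c > 0" and c: "\<And>i (u::unit). \<bar>max (?N (C i)) (?N (matrix_inv (C i)))\<bar> \<le> c"
    using finite_matrix_bound[of "\<lambda>i (u::unit). max (?N (C i)) (?N (matrix_inv (C i)))"] by metis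
  have N_nonneg: "?N B \<ge> 0" for B
    by (rule onorm_pos_le) simp
  have entry: "\<bar>(L ** (B ** R)) $ i $ j\<bar> \<le> c * (?N B * c)" if "?N L \<le> c" "?N R \<le> c" for L B R i j
  proof -
    have "\<bar>(L ** (B ** R)) $ i $ j\<bar> \<le> ?N (L ** (B ** R))"
      by (rule matrix_component_le_onorm)
    also have "\<dots> \<le> ?N L * (?N B * ?N R)"
      by (intro order_trans[OF onorm_matrix_mult_le] mult_left_mono onorm_matrix_mult_le N_nonneg)
    also have "\<dots> \<le> c * (?N B * c)"
      using that c0 by (intro mult_mono mult_left_mono) (auto simp: N_nonneg)
    finally show ?thesis .
  qed
  have "\<bar>\<Sum>k<n. ln \<bar>diag_ratio (edge_matrix A C (x k) (x (Suc k)))\<bar>\<bar>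
    \<le> ln (c ^ 4) + (ln (?N (cocycle A x n)) + ln (?N (matrix_inv (cocycle A x n))))"
    if tri: "\<forall>k. upper_triangular2 (edge_matrix A C (x k) (x (Suc k)))" for x n
  proof -
    let ?U = "edge_product (edge_matrix A C) x"
    define V where "V n s = (1 / s) *\<^sub>R (matrix_inv (C (x 0)) ** (matrix_inv (cocycle A x n) ** C (x n)))"
      for n s
    have VU: "V n s ** ?U n = mat 1"
      if "s > 0" "?U n = s *\<^sub>R (matrix_inv (C (x n)) ** (cocycle A x n ** C (x 0)))" for n s
      using that(1) unfolding that(2) V_def
      by (simp add: matrix_scalar_ac matrix_mul_assoc[symmetric] matrix_inv_cancel_right
          matrix_inv_cancel_left matrix_inv_mult_left C invertible_cocycle A
          flip: scalar_matrix_assoc)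
    have inv: "invertible (?U n)" for n
      using edge_product_conjugate[of A C x n, OF A C] VU
      by (metis invertible_left_inverse)
    obtain s where s: "s > 0" "?U n = s *\<^sub>R (matrix_inv (C (x n)) ** (cocycle A x n ** C (x 0)))"
      using edge_product_conjugate[of A C x n, OF A C] by blast
    let ?b = "?N (cocycle A x n)" and ?b' = "?N (matrix_inv (cocycle A x n))"
    have NC: "?N (C i) \<le> c" "?N (matrix_inv (C i)) \<le> c" for i
      using c[of i] by auto
    have U_le: "\<bar>?U n $ i $ i\<bar> \<le> s * (c * (?b * c))" for i
      using s entry[OF NC(2) NC(1), of "x n" "cocycle A x n" "x 0" i i]
      by (simp add: abs_mult)
    have V_le: "\<bar>V n s $ i $ i\<bar> \<le> (1 / s) * (c * (?b' * c))" for i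
      using s(1) entry[OF NC(2) NC(1), of "x 0" "matrix_inv (cocycle A x n)" "x n" i i]
      by (simp add: V_def abs_mult divide_right_mono)
    have UV_le: "\<bar>?U n $ i $ i * V n s $ j $ j\<bar> \<le> c ^ 4 * (?b * ?b')" for i j
    proof -
      have "\<bar>?U n $ i $ i * V n s $ j $ j\<bar> \<le> (s * (c * (?b * c))) * ((1 / s) * (c * (?b' * c)))"
        unfolding abs_mult using s(1) c0 by (intro mult_mono U_le V_le) (auto simp: N_nonneg)
      also have "\<dots> = c ^ 4 * (?b * ?b')"
        using s(1) by (simp add: power4_eq_xxxx)
      finally show ?thesis .
    qed
    note diag = sum_ln_diag_ratio[of "edge_matrix A C" x n, OF _ inv]
    have upper: "upper_triangular2 (?U n)"
      using diag(1) tri by blast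
    note VU1 = left_inverse_upper_triangular2[OF VU[OF s] upper]
    then have nz: "?U n $ 1 $ 1 \<noteq> 0" "?U n $ 2 $ 2 \<noteq> 0"
      by auto
    have V: "V n s $ 1 $ 1 = 1 / ?U n $ 1 $ 1" "V n s $ 2 $ 2 = 1 / ?U n $ 2 $ 2"
      using VU1 nz by (simp_all add: field_simps)
    have ratio: "\<bar>diag_ratio (?U n)\<bar> > 0" "\<bar>diag_ratio (?U n)\<bar> \<le> c ^ 4 * (?b * ?b')"
        "1 / \<bar>diag_ratio (?U n)\<bar> \<le> c ^ 4 * (?b * ?b')"
      using nz UV_le[of 1 2] UV_le[of 2 1] by (simp_all add: diag_ratio_def V)
    have inv_inv: "invertible (matrix_inv (cocycle A x n))"
      unfolding invertible_def
      by (intro exI[of _ "cocycle A x n"] conjI matrix_inv_mult_left matrix_inv_mult_right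
          invertible_cocycle A)
    have pos: "?b > 0" "?b' > 0"
      by (intro onorm_invertible_pos invertible_cocycle A inv_inv)+
    have "\<bar>ln \<bar>diag_ratio (?U n)\<bar>\<bar> \<le> ln (c ^ 4 * (?b * ?b'))"
    proof (rule abs_leI)
      show "ln \<bar>diag_ratio (?U n)\<bar> \<le> ln (c ^ 4 * (?b * ?b'))"
        using ratio by (intro ln_mono) auto
      have "ln (1 / \<bar>diag_ratio (?U n)\<bar>) \<le> ln (c ^ 4 * (?b * ?b'))"
        using ratio by (intro ln_mono) auto
      then show "- ln \<bar>diag_ratio (?U n)\<bar> \<le> ln (c ^ 4 * (?b * ?b'))"
        using ratio(1) by (simp add: ln_div)
    qed
    also have "\<dots> = ln (c ^ 4) + (ln ?b + ln ?b')"
      using pos c0 by (simp add: ln_mult)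
    finally show ?thesis
      using diag(2) tri by simp
  qed
  then show ?thesis
    by blast
qed

text \<open>Equality of the exponents enters through the common value \<open>l\<close>: the norm
  bound divided by \<open>n\<close> is K / n plus the difference of the two sequences defining the
  exponents, and tends to l - l = 0.\<close>

lemma (in finite_markov_chain) mean_ln_diag_ratio:
  assumes "stationary_distribution P p"
    and A: "\<And>i. invertible (A i)" and C: "\<And>i. invertible (C i)"
    and "has_upper_lyapunov_exponent M X A l" and "has_lower_lyapunov_exponent M X A l"
    and tri: "\<And>i j. P $ i $ j > 0 \<Longrightarrow> upper_triangular2 (edge_matrix A C i j)"
  shows "(\<Sum>i\<in>UNIV. p $ i * (\<Sum>j\<in>UNIV. P $ i $ j * ln \<bar>diag_ratio (edge_matrix A C i j)\<bar>)) = 0"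
proof (rule edge_mean_zero[OF assms(1)])
  obtain K where K: "\<And>x n. (\<forall>k. upper_triangular2 (edge_matrix A C (x k) (x (Suc k)))) \<Longrightarrow>
      \<bar>\<Sum>k<n. ln \<bar>diag_ratio (edge_matrix A C (x k) (x (Suc k)))\<bar>\<bar>
      \<le> K + (ln (onorm ((*v) (cocycle A x n))) + ln (onorm ((*v) (matrix_inv (cocycle A x n)))))"
    using sum_ln_diag_ratio_le[of A C, OF A C] by blast
  have "AE \<omega> in M. (\<lambda>n. 1 / real n * ln (onorm ((*v) (cocycle A (\<lambda>k. X k \<omega>) n)))) \<longlonglongrightarrow> l"
    using assms(4) by (simp add: has_upper_lyapunov_exponent_def)
  moreover have "AE \<omega> in M. (\<lambda>n. - (1 / real n * ln (onorm ((*v) (matrix_inv (cocycle A (\<lambda>k. X k \<omega>) n))))))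
      \<longlonglongrightarrow> l"
    using assms(5) by (simp add: has_lower_lyapunov_exponent_def)
  ultimately show "AE \<omega> in M. (\<lambda>n. (\<Sum>k<n. ln \<bar>diag_ratio (edge_matrix A C (X k \<omega>) (X (Suc k) \<omega>))\<bar>) / real n)
      \<longlonglongrightarrow> 0"
    using AE_allowed_edges
  proof eventually_elim
    case (elim \<omega>)
    let ?x = "\<lambda>k. X k \<omega>"
    let ?a = "\<lambda>n. 1 / real n * ln (onorm ((*v) (cocycle A ?x n)))"
    let ?b = "\<lambda>n. - (1 / real n * ln (onorm ((*v) (matrix_inv (cocycle A ?x n)))))"
    have "(\<lambda>n. K / real n + (?a n - ?b n)) \<longlonglongrightarrow> 0 + (l - l)"
      by (intro tendsto_add tendsto_diff elim(1,2)) real_asymp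
    then have "(\<lambda>n. K / real n + (?a n - ?b n)) \<longlonglongrightarrow> 0"
      by simp
    moreover have "norm ((\<Sum>k<n. ln \<bar>diag_ratio (edge_matrix A C (?x k) (?x (Suc k)))\<bar>) / real n)
        \<le> K / real n + (?a n - ?b n)" for n
    proof -
      have "\<bar>\<Sum>k<n. ln \<bar>diag_ratio (edge_matrix A C (?x k) (?x (Suc k)))\<bar>\<bar> / real n
          \<le> (K + (ln (onorm ((*v) (cocycle A ?x n)))
              + ln (onorm ((*v) (matrix_inv (cocycle A ?x n)))))) / real n"
        using tri elim(3) by (intro divide_right_mono K) auto
      then show ?thesis
        by (simp add: add_divide_distrib)
    qed
    ultimately show ?case
      by (rule Lim_null_comparison[OF always_eventually[OF allI], rotated])
  qed
qed

section \<open>Assembly of the tail and mean bounds\<close>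

theorem lemma6p3:
  fixes P :: "real^'n^'n" and p :: "real^'n"
    and A C :: "'n \<Rightarrow> real^2^2"
    and M :: "'w measure" and X :: "nat \<Rightarrow> 'w \<Rightarrow> 'n"
    and T :: "'n \<Rightarrow> 'n \<Rightarrow> real^2^2"
    and \<rho> \<beta> :: "'n \<Rightarrow> 'n \<Rightarrow> real"
    and Z :: "nat \<Rightarrow> 'w \<Rightarrow> real"
    and lp lm :: real
  assumes "stochastic P" and "primitive P"
    and "stationary_distribution P p"
    and "markov_chain M X P p"
    and "\<And>i. invertible (A i)"
    and "has_upper_lyapunov_exponent M X A lp"
    and "has_lower_lyapunov_exponent M X A lm"
    and "lp = lm"
    and "\<And>i. invertible (C i)"
    and T_def: "T = edge_matrix A C"
    and "\<And>i j. P $ i $ j > 0 \<Longrightarrow> upper_triangular2 (T i j)"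
    and "\<not> simultaneously_diagonalizable {T i j | i j. P $ i $ j > 0}"
    and rho_def: "\<rho> = (\<lambda>i j. diag_ratio (T i j))"
    and beta_def: "\<beta> = (\<lambda>i j. offdiag_ratio (T i j))"
    and Z_def: "Z = (\<lambda>n \<omega>. affine_orbit \<rho> \<beta> (\<lambda>k. X k \<omega>) n)"
  shows "\<exists>K c :: real. K > 0 \<and> c > 0 \<and>
    (\<forall>n\<ge>1. \<forall>t\<ge>0.
       \<P>(\<omega> in M. ln (1 + \<bar>Z n \<omega>\<bar>) > K + ln (real n + 1) + t) \<le> K * exp (- c * (t\<^sup>2 / real n))) \<and>
    (\<forall>n\<ge>1.
       prob_space.expectation M (\<lambda>\<omega>. ln (1 + \<bar>Z n \<omega>\<bar>)) \<le> K * sqrt (real n) + K * ln (real n + 1))"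
proof -
  interpret finite_markov_chain M X P p
    using assms(1,4) by (auto simp: finite_markov_chain_def finite_markov_chain_axioms_def markov_chain_def)
  define f where "f i j = ln \<bar>\<rho> i j\<bar>" for i j
  define h where "h = (\<chi> i. \<Sum>j\<in>UNIV. P $ i $ j * f i j)"
  have "p \<bullet> h = 0"
    using mean_ln_diag_ratio[OF assms(3,5,9), where l = lp] assms(6,7,8,11)
    by (simp add: h_def f_def inner_vec_def rho_def T_def)
  then obtain g where g: "g - P *v g = h"
    using poisson_equation assms(1,2,3) by blast
  \<comment> \<open>The coboundary of \<open>g\<close> cancels the conditional drift
    \<open>h\<close>, so \<open>D\<close> has mean 0 from every state and not only on average under
    \<open>p\<close>.\<close>
  define D where "D i j = f i j + g $ j - g $ i" for i j
  have mean: "(\<Sum>j\<in>UNIV. P $ i $ j * D i j) = 0" for i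
  proof -
    have "(\<Sum>j\<in>UNIV. P $ i $ j * D i j) = h $ i + (P *v g) $ i - (\<Sum>j\<in>UNIV. P $ i $ j) * g $ i"
      by (simp add: D_def h_def matrix_vector_mult_def distrib_left right_diff_distrib
          sum.distrib sum_subtractf sum_distrib_right)
    also have "\<dots> = 0"
      using assms(1) unfolding g[symmetric] by (simp add: stochastic_def)
    finally show ?thesis .
  qed
  obtain B where B: "B > 0" "\<And>i j. \<bar>D i j\<bar> \<le> B"
    using finite_matrix_bound[of D] by metis
  obtain b where b: "b > 0" "\<And>i j. \<bar>\<beta> i j\<bar> \<le> b"
    using finite_matrix_bound[of \<beta>] by metis
  obtain G where G: "\<And>i (u::unit). \<bar>g $ i\<bar> \<le> G"
    using finite_matrix_bound[of "\<lambda>i (u::unit). g $ i"] by metis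
  \<comment> \<open>Equality holds when \<open>\<rho> i j\<close> is nonzero. On forbidden pairs it
    may be 0, and then the bound holds because exp is positive.\<close>
  have \<rho>: "\<bar>\<rho> i j\<bar> \<le> exp (D i j + g $ i - g $ j)" for i j
    by (cases "\<rho> i j = 0") (auto simp: D_def f_def)
  define K0 where "K0 = ln (1 + b * exp (2 * G))"
  let ?w = "\<lambda>n \<omega>. reflected_walk D (\<lambda>k. X k \<omega>) n"
  have K0: "K0 \<ge> 0"
    using b(1) by (simp add: K0_def)
  have Z: "ln (1 + \<bar>Z n \<omega>\<bar>) \<le> K0 + ln (real n + 1) + ?w n \<omega>" for n \<omega>
    unfolding Z_def K0_def by (rule ln_affine_orbit_le_reflected_walk[OF \<rho> b(2) G])
  \<comment> \<open>\<open>K\<close> has to be at least \<open>K0\<close> to shift the event, 2 as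
    the tail prefactor, K0 + 2 exp (B^2) as the coefficient of sqrt n, and 1 for the logarithmic
    term.\<close>
  define K where "K = K0 + 2 + 2 * exp (B\<^sup>2)"
  define c where "c = 1 / (4 * B\<^sup>2)"
  have tail: "\<P>(\<omega> in M. ln (1 + \<bar>Z n \<omega>\<bar>) > K + ln (real n + 1) + t) \<le> K * exp (- c * (t\<^sup>2 / real n))"
    if "n \<ge> 1" "t \<ge> 0" for n t
  proof -
    have [measurable]: "?w n \<in> borel_measurable M"
      using reflected_walk_integrable by auto
    have "K0 \<le> K"
      by (simp add: K_def)
    have "\<P>(\<omega> in M. ln (1 + \<bar>Z n \<omega>\<bar>) > K + ln (real n + 1) + t) \<le> \<P>(\<omega> in M. ?w n \<omega> > t)"
    proof (rule finite_measure_mono)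
      show "{\<omega> \<in> space M. ln (1 + \<bar>Z n \<omega>\<bar>) > K + ln (real n + 1) + t} \<subseteq> {\<omega> \<in> space M. ?w n \<omega> > t}"
      proof clarify
        fix \<omega> assume "ln (1 + \<bar>Z n \<omega>\<bar>) > K + ln (real n + 1) + t"
        then show "?w n \<omega> > t"
          using Z[of n \<omega>] \<open>K0 \<le> K\<close> by linarith
      qed
    qed measurable
    also have "\<dots> \<le> 2 * exp (- (t\<^sup>2 / (4 * B\<^sup>2 * real n)))"
      using reflected_walk_tail[OF mean B(2,1)] that by blast
    also have "\<dots> \<le> K * exp (- c * (t\<^sup>2 / real n))"
      using K0 by (simp add: K_def c_def)
    finally show ?thesis .
  qed
  have expect: "expectation (\<lambda>\<omega>. ln (1 + \<bar>Z n \<omega>\<bar>)) \<le> K * sqrt (real n) + K * ln (real n + 1)"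
    if "n \<ge> 1" for n
  proof -
    have "integrable M (\<lambda>\<omega>. ln (1 + \<bar>Z n \<omega>\<bar>))"
      unfolding Z_def
      by (rule path_integrable[of n "\<lambda>x. ln (1 + \<bar>affine_orbit \<rho> \<beta> x n\<bar>)"]) (metis affine_orbit_cong)
    then have "expectation (\<lambda>\<omega>. ln (1 + \<bar>Z n \<omega>\<bar>)) \<le> expectation (\<lambda>\<omega>. K0 + ln (real n + 1) + ?w n \<omega>)"
      by (intro integral_mono Z) (auto intro: reflected_walk_integrable)
    also have "\<dots> = K0 + ln (real n + 1) + expectation (?w n)"
      by (simp add: reflected_walk_integrable prob_space)
    also have "\<dots> \<le> K0 * sqrt (real n) + K * ln (real n + 1) + 2 * exp (B\<^sup>2) * sqrt (real n)"
    proof (intro add_mono)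
      show "K0 \<le> K0 * sqrt (real n)"
        using K0 that by (simp add: mult_le_cancel_left1)
      have "1 \<le> K"
        using K0 by (simp add: K_def add_nonneg_nonneg)
      then show "ln (real n + 1) \<le> K * ln (real n + 1)"
        by (simp add: mult_le_cancel_right1)
      show "expectation (?w n) \<le> 2 * exp (B\<^sup>2) * sqrt (real n)"
        by (rule reflected_walk_mean[OF mean B(2) that])
    qed
    also have "\<dots> \<le> K * sqrt (real n) + K * ln (real n + 1)"
      by (simp add: K_def algebra_simps)
    finally show ?thesis .
  qed
  have "K > 0" "c > 0"
    using K0 B(1) by (simp_all add: K_def c_def add_nonneg_pos)
  with tail expect show ?thesis
    by blast
qed

end
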